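(* A Jacobi matrix is oscillatory if and only if it admits a positive bidiagonal factorization (PBF).
   Context: A Jacobi matrix is a real semi-infinite tridiagonal matrix $J=(J_{i,j})_{i,j\ge0}$ with all entries of the first superdiagonal equal to $1$, real diagonal entries, positive entries on the first subdiagonal, and all other entries zero. A finite matrix is totally nonnegative (TN) if all its minors are nonnegative, and oscillatory if it is TN and some power of it has all minors positive (equivalently, TN, irreducible and nonsingular). A semi-infinite matrix is called oscillatory if all its leading principal submatrices are oscillatory. A PBF of a Jacobi matrix $J$ is a factorization $J=LU$ where $L$ is lower unitriangular bidiagonal with first subdiagonal $(\beta_2,\beta_4,\beta_6,\dots)$, $U$ is upper bidiagonal with diagonal $(\beta_1,\beta_3,\beta_5,\dots)$ and first superdiagonal of ones, and $\beta_n>0$ for all $n\in\mathbb N$. *)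

theory Defs
  imports Complex_Main "Jordan_Normal_Form.Determinant"
    "Jordan_Normal_Form.DL_Submatrix"
begin

text \<open>
  Finite matrices are those of Jordan_Normal_Form.  The minor with row set \<open>I\<close> and column set \<open>J\<close>
  is \<open>det (submatrix A I J)\<close>.  Empty index sets are not excluded; the corresponding minor is the
  determinant of the empty matrix, which is 1, so it affects neither condition.
\<close>

definition totally_nonneg :: "real mat \<Rightarrow> bool" where
  "totally_nonneg A \<longleftrightarrow>
    (\<forall>I J. I \<subseteq> {..<dim_row A} \<and> J \<subseteq> {..<dim_col A} \<and> card I = card J
       \<longrightarrow> det (submatrix A I J) \<ge> 0)"

definition totally_pos :: "real mat \<Rightarrow> bool" where
  "totally_pos A \<longleftrightarrow>
    (\<forall>I J. I \<subseteq> {..<dim_row A} \<and> J \<subseteq> {..<dim_col A} \<and> card I = card J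
       \<longrightarrow> det (submatrix A I J) > 0)"

text \<open>
  The exponent must be positive: otherwise the zeroth power would make the singular \<open>1 \<times> 1\<close>
  zero matrix oscillatory.
\<close>

definition oscillatory_mat :: "real mat \<Rightarrow> bool" where
  "oscillatory_mat A \<longleftrightarrow>
    square_mat A \<and> totally_nonneg A \<and> (\<exists>k>0. totally_pos (A ^\<^sub>m k))"

type_synonym smat = "nat \<Rightarrow> nat \<Rightarrow> real"

definition leading_submat :: "smat \<Rightarrow> nat \<Rightarrow> real mat" where
  "leading_submat A n = mat n n (\<lambda>(i, j). A i j)"

definition oscillatory_smat :: "smat \<Rightarrow> bool" where
  "oscillatory_smat A \<longleftrightarrow> (\<forall>n\<ge>1. oscillatory_mat (leading_submat A n))"

definition jacobi_matrix :: "smat \<Rightarrow> bool" where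
  "jacobi_matrix J \<longleftrightarrow>
    (\<forall>i. J i (i + 1) = 1) \<and>
    (\<forall>i. J (i + 1) i > 0) \<and>
    (\<forall>i j. j > i + 1 \<or> i > j + 1 \<longrightarrow> J i j = 0)"

text \<open>
  The series below is meaningful only if it converges; it is a finite sum
  whenever the left factor is lower triangular, see \<open>smat_mult_lower_triangular\<close>.
\<close>

definition smat_mult :: "smat \<Rightarrow> smat \<Rightarrow> smat" where
  "smat_mult A B = (\<lambda>i j. \<Sum>k. A i k * B k j)"

lemma smat_mult_lower_triangular:
  assumes "\<And>k. k > i \<Longrightarrow> A i k = 0"
  shows "smat_mult A B i j = (\<Sum>k\<le>i. A i k * B k j)"
  unfolding smat_mult_def by (rule suminf_finite) (auto simp: assms not_le)

text \<open>
  In the two bidiagonal factors rows and columns are numbered from 0 and the parameters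
  \<open>\<beta> 1, \<beta> 2, \<dots>\<close> from 1; the value \<open>\<beta> 0\<close> is never used.
\<close>

definition pbf_L :: "(nat \<Rightarrow> real) \<Rightarrow> smat" where
  "pbf_L \<beta> i j = (if i = j then 1 else if i = j + 1 then \<beta> (2 * j + 2) else 0)"

definition pbf_U :: "(nat \<Rightarrow> real) \<Rightarrow> smat" where
  "pbf_U \<beta> i j = (if i = j then \<beta> (2 * i + 1) else if j = i + 1 then 1 else 0)"

definition admits_PBF :: "smat \<Rightarrow> bool" where
  "admits_PBF J \<longleftrightarrow> (\<exists>\<beta>. (\<forall>n\<ge>1. \<beta> n > 0) \<and> J = smat_mult (pbf_L \<beta>) (pbf_U \<beta>))"

end

theory Submission
  imports Defs
begin

text \<open>
  A positive factorization makes every truncation a product of two bidiagonal matrices.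
  Left multiplication by a nonnegative bidiagonal matrix expands a minor as a nonnegative
  combination of minors with slightly shifted rows; this gives total nonnegativity, and since
  any row set can be shifted step by step into any other, a large power is totally positive.
  Conversely, oscillation forces the leading principal minors, hence all pivots of Gaussian
  elimination, to be positive, and the pivots are the diagonal of the upper factor.
\<close>

section \<open>Minors along selections of rows and columns\<close>

text \<open>
  Arbitrary selections \<open>r\<close> and \<open>s\<close> replace index sets because expanding a minor of a
  product along its rows also produces repeated rows.
\<close>

definition minor_at :: "nat \<Rightarrow> 'a :: comm_ring_1 mat \<Rightarrow> (nat \<Rightarrow> nat) \<Rightarrow> (nat \<Rightarrow> nat) \<Rightarrow> 'a" where
  "minor_at m A r s = det (mat m m (\<lambda>(a, b). A $$ (r a, s b)))"

lemma minor_at_cong: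
  assumes "\<And>a. a < m \<Longrightarrow> r a = r' a"
  shows "minor_at m A r s = minor_at m A r' s"
  unfolding minor_at_def by (rule arg_cong[of _ _ det]) (auto intro!: eq_matI simp: assms)

lemma minor_at_not_inj:
  assumes "\<not> inj_on r {..<m}"
  shows "minor_at m A r s = 0"
proof -
  obtain a b where ab: "a < m" "b < m" "a \<noteq> b" "r a = r b"
    using assms by (auto simp: inj_on_def)
  show ?thesis
    unfolding minor_at_def
    by (rule det_identical_rows[OF _ ab(3,1,2)]) (use ab in \<open>auto intro!: eq_vecI\<close>)
qed

lemma submatrix_minor:
  assumes "card {i. i < dim_row A \<and> i \<in> I} = m" "card {j. j < dim_col A \<and> j \<in> J} = m"
  shows "det (submatrix A I J) = minor_at m A (pick I) (pick J)"
  unfolding submatrix_def minor_at_def assms ..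

text \<open>Such an \<open>r\<close> encodes a set of \<open>m\<close> indices below
  \<open>n\<close>; its values from \<open>m\<close> on are arbitrary.\<close>

definition increasing_below :: "nat \<Rightarrow> nat \<Rightarrow> (nat \<Rightarrow> nat) \<Rightarrow> bool" where
  "increasing_below m n r \<longleftrightarrow> strict_mono_on {..<m} r \<and> r \<in> {..<m} \<rightarrow> {..<n}"

lemma increasing_below_pick:
  assumes "I \<subseteq> {..<n}"
  shows "increasing_below (card I) n (pick I)"
  using assms pick_in_set_le[of _ I] pick_mono_le[of _ I]
  by (auto simp: increasing_below_def strict_mono_on_def)

text \<open>Both ranges have \<open>m\<close> elements, so inclusion makes them equal, and a finite
  set has only one increasing enumeration.\<close>

lemma increasing_below_eqI:
  assumes "increasing_below m n r" "increasing_below m n s" "r ` {..<m} \<subseteq> s ` {..<m}" "a < m"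
  shows "r a = s a"
proof -
  have inj: "inj_on r {..<m}" "inj_on s {..<m}"
    using assms(1,2) by (auto simp: increasing_below_def intro: strict_mono_on_imp_inj_on)
  have "r ` {..<m} = s ` {..<m}"
    by (rule card_subset_eq) (use assms(3) inj in \<open>auto simp: card_image\<close>)
  moreover have "sorted_wrt (<) (map f [0..<m])" if "increasing_below m n f" for f
    using that by (auto simp: sorted_wrt_iff_nth_less increasing_below_def strict_mono_on_def)
  ultimately have "map r [0..<m] = map s [0..<m]"
    using assms(1,2) by (intro sorted_distinct_set_unique)
      (auto simp: strict_sorted_iff lessThan_atLeast0)
  then show ?thesis
    using assms(4) by simp
qed

lemma minor_one_diag:
  assumes "increasing_below m n s" "\<And>a. a < m \<Longrightarrow> r a = s a"
  shows "minor_at m (1\<^sub>m n :: 'a :: comm_ring_1 mat) r s = 1"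
proof -
  have inj: "inj_on s {..<m}" and bnd: "\<And>a. a < m \<Longrightarrow> s a < n"
    using assms(1) by (auto simp: increasing_below_def intro: strict_mono_on_imp_inj_on)
  have "mat m m (\<lambda>(a, b). (1\<^sub>m n :: 'a mat) $$ (r a, s b)) = 1\<^sub>m m"
    by (rule eq_matI) (use assms(2) bnd inj in \<open>auto simp: inj_on_eq_iff\<close>)
  then show ?thesis
    by (simp add: minor_at_def)
qed

text \<open>Either both selections agree and the selected matrix is the identity, or some selected
  row misses every selected column and vanishes. This starts the induction over powers.\<close>

lemma minor_one_nonneg:
  assumes "increasing_below m n r" "increasing_below m n s"
  shows "minor_at m (1\<^sub>m n :: real mat) r s \<ge> 0"
proof (cases "r ` {..<m} \<subseteq> s ` {..<m}")
  case True
  show ?thesis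
    by (simp add: minor_one_diag[OF assms(2) increasing_below_eqI[OF assms True]])
next
  case False
  then obtain a where a: "a < m" "r a \<notin> s ` {..<m}" by auto
  let ?M = "mat m m (\<lambda>(a, b). (1\<^sub>m n :: real mat) $$ (r a, s b))"
  have "?M $$ (a, b) = 0" if "b < m" for b
  proof -
    have "r a < n" "s b < n"
      using a that assms by (auto simp: increasing_below_def)
    then show ?thesis
      using a that by auto
  qed
  then have "det ?M = 0"
    using a by (subst laplace_expansion_row[of _ m a]) auto
  then show ?thesis
    by (simp add: minor_at_def)
qed

text \<open>Each row of the product is a combination of rows of \<open>B\<close>, and the
  determinant is linear in every row. This is Cauchy-Binet before the terms are grouped by row sets.
  Fixing \<open>f i = i\<close> outside the range keeps the index set finite.\<close>

lemma minor_mult: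
  fixes A B :: "'a :: comm_ring_1 mat"
  assumes A: "A \<in> carrier_mat nr n" and B: "B \<in> carrier_mat n nc"
    and r: "r \<in> {..<m} \<rightarrow> {..<nr}" and s: "s \<in> {..<m} \<rightarrow> {..<nc}"
  shows "minor_at m (A * B) r s =
    (\<Sum>f | (\<forall>i\<in>{0..<m}. f i \<in> {0..<n}) \<and> (\<forall>i. i \<notin> {0..<m} \<longrightarrow> f i = i).
       (\<Prod>a\<in>{0..<m}. A $$ (r a, f a)) * minor_at m B f s)"
proof -
  let ?X = "mat m n (\<lambda>(a, k). A $$ (r a, k))"
  let ?Y = "mat n m (\<lambda>(k, b). B $$ (k, s b))"
  have rs: "r a < nr" "s a < nc" if "a < m" for a
    using r s that by auto
  have "mat m m (\<lambda>(a, b). (A * B) $$ (r a, s b)) = ?X * ?Y"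
    by (rule eq_matI) (use A B rs in \<open>auto simp: scalar_prod_def\<close>)
  also have "\<dots> = mat\<^sub>r m m (\<lambda>i. finsum_vec TYPE('a) m (\<lambda>k. ?X $$ (i, k) \<cdot>\<^sub>v row ?Y k) {0..<n})"
    by (rule mat_mul_finsum_alt) auto
  finally have "minor_at m (A * B) r s =
      det (mat\<^sub>r m m (\<lambda>i. finsum_vec TYPE('a) m (\<lambda>k. ?X $$ (i, k) \<cdot>\<^sub>v row ?Y k) {0..<n}))"
    by (simp only: minor_at_def)
  also have "\<dots> = (\<Sum>f | (\<forall>i\<in>{0..<m}. f i \<in> {0..<n}) \<and> (\<forall>i. i \<notin> {0..<m} \<longrightarrow> f i = i).
      det (mat\<^sub>r m m (\<lambda>i. ?X $$ (i, f i) \<cdot>\<^sub>v row ?Y (f i))))"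
    by (rule det_linear_rows_sum) auto
  also have "\<dots> = (\<Sum>f | (\<forall>i\<in>{0..<m}. f i \<in> {0..<n}) \<and> (\<forall>i. i \<notin> {0..<m} \<longrightarrow> f i = i).
       (\<Prod>a\<in>{0..<m}. A $$ (r a, f a)) * minor_at m B f s)"
  proof (rule sum.cong[OF refl])
    fix f :: "nat \<Rightarrow> nat"
    assume "f \<in> {f. (\<forall>i\<in>{0..<m}. f i \<in> {0..<n}) \<and> (\<forall>i. i \<notin> {0..<m} \<longrightarrow> f i = i)}"
    then have f: "f i < n" if "i < m" for i
      using that by auto
    have "row ?Y (f i) \<in> carrier_vec m" for i
      by (rule carrier_vecI) simp
    then have "det (mat\<^sub>r m m (\<lambda>i. ?X $$ (i, f i) \<cdot>\<^sub>v row ?Y (f i))) =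
        (\<Prod>a\<in>{0..<m}. ?X $$ (a, f a)) * det (mat\<^sub>r m m (\<lambda>i. row ?Y (f i)))"
      by (intro det_rows_mul) simp
    moreover have "(\<Prod>a\<in>{0..<m}. ?X $$ (a, f a)) = (\<Prod>a\<in>{0..<m}. A $$ (r a, f a))"
      using f by simp
    moreover have "mat\<^sub>r m m (\<lambda>i. row ?Y (f i)) = mat m m (\<lambda>(a, b). B $$ (f a, s b))"
      by (rule eq_matI) (use f in auto)
    ultimately show "det (mat\<^sub>r m m (\<lambda>i. ?X $$ (i, f i) \<cdot>\<^sub>v row ?Y (f i))) =
        (\<Prod>a\<in>{0..<m}. A $$ (r a, f a)) * minor_at m B f s"
      by (simp only: minor_at_def)
  qed
  finally show ?thesis .
qed

section \<open>Products with a noncrossing left factor\<close>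

text \<open>
  Bidiagonal matrices satisfy this: their supports do not cross, so that in the expansion
  \<open>minor_mult\<close> of a minor only weakly increasing row selections contribute.
\<close>

definition noncrossing_nonneg :: "real mat \<Rightarrow> bool" where
  "noncrossing_nonneg A \<longleftrightarrow>
    (\<forall>i<dim_row A. \<forall>k<dim_col A. A $$ (i, k) \<ge> 0) \<and>
    (\<forall>i j k l. i < j \<and> j < dim_row A \<and> k < dim_col A \<and> l < dim_col A \<and>
       A $$ (i, k) \<noteq> 0 \<and> A $$ (j, l) \<noteq> 0 \<longrightarrow> k \<le> l)"

text \<open>A nonzero coefficient forces \<open>f\<close> to be weakly increasing. Then either
  \<open>f\<close> repeats a row and the minor vanishes, or \<open>f\<close> is strictly increasing
  and the assumption on \<open>B\<close> applies.\<close>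

lemma noncrossing_term_nonneg:
  fixes A B :: "real mat"
  assumes A: "A \<in> carrier_mat nr n" "noncrossing_nonneg A"
    and B: "\<And>f. increasing_below m n f \<Longrightarrow> minor_at m B f s \<ge> 0"
    and r: "increasing_below m nr r"
    and f: "f \<in> {..<m} \<rightarrow> {..<n}"
  shows "(\<Prod>a\<in>{0..<m}. A $$ (r a, f a)) * minor_at m B f s \<ge> 0"
proof (cases "(\<Prod>a\<in>{0..<m}. A $$ (r a, f a)) = 0")
  case True
  then show ?thesis by (simp only: mult_zero_left order_refl)
next
  case False
  then have nz: "A $$ (r a, f a) \<noteq> 0" if "a < m" for a
    using that by auto
  have bnd: "r a < nr" "f a < n" if "a < m" for a
    using that r f by (auto simp: increasing_below_def)
  have mono: "f a \<le> f b" if "a < b" "b < m" for a b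
  proof -
    have "r a < r b"
      using that r by (auto simp: increasing_below_def strict_mono_on_def)
    then show ?thesis
      using A nz[of a] nz[of b] bnd[of a] bnd[of b] that
      unfolding noncrossing_nonneg_def by (auto dest: spec[of _ "r a"])
  qed
  have "(\<Prod>a\<in>{0..<m}. A $$ (r a, f a)) \<ge> 0"
    using A bnd by (intro prod_nonneg) (auto simp: noncrossing_nonneg_def)
  moreover have "minor_at m B f s \<ge> 0"
  proof (cases "inj_on f {..<m}")
    case True
    then have "strict_mono_on {..<m} f"
      using mono by (auto simp: strict_mono_on_def inj_on_def order.strict_iff_order)
    then show ?thesis
      using f by (intro B) (auto simp: increasing_below_def)
  qed (simp add: minor_at_not_inj)
  ultimately show ?thesis
    by (rule mult_nonneg_nonneg)
qed

lemma minor_noncrossing_mult_nonneg: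
  fixes A B :: "real mat"
  assumes A: "A \<in> carrier_mat nr n" "noncrossing_nonneg A" and B: "B \<in> carrier_mat n nc"
    and pos: "\<And>f. increasing_below m n f \<Longrightarrow> minor_at m B f s \<ge> 0"
    and r: "increasing_below m nr r" and s: "increasing_below m nc s"
  shows "minor_at m (A * B) r s \<ge> 0"
proof -
  have rs: "r \<in> {..<m} \<rightarrow> {..<nr}" "s \<in> {..<m} \<rightarrow> {..<nc}"
    using r s by (auto simp: increasing_below_def)
  show ?thesis
    unfolding minor_mult[OF A(1) B rs]
    by (intro sum_nonneg noncrossing_term_nonneg[OF A pos r]) auto
qed

text \<open>No term of the expansion is negative, so the single positive term belonging to
  \<open>g\<close> suffices.\<close>

lemma minor_noncrossing_mult_pos:
  fixes A B :: "real mat"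
  assumes A: "A \<in> carrier_mat nr n" "noncrossing_nonneg A" and B: "B \<in> carrier_mat n nc"
    and pos: "\<And>f. increasing_below m n f \<Longrightarrow> minor_at m B f s \<ge> 0"
    and r: "increasing_below m nr r" and s: "increasing_below m nc s"
    and g: "increasing_below m n g" "minor_at m B g s > 0"
    and gA: "\<And>a. a < m \<Longrightarrow> A $$ (r a, g a) > 0"
  shows "minor_at m (A * B) r s > 0"
proof -
  let ?F = "{f. (\<forall>i\<in>{0..<m}. f i \<in> {0..<n}) \<and> (\<forall>i. i \<notin> {0..<m} \<longrightarrow> f i = i)}"
  \<comment> \<open>The expansion ranges over maps that are the identity from \<open>m\<close> on,
    so \<open>g\<close> is adjusted there.\<close>
  define h where "h a = (if a < m then g a else a)" for a
  have "minor_at m B h s = minor_at m B g s"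
    by (rule minor_at_cong) (simp add: h_def)
  moreover have "(\<Prod>a\<in>{0..<m}. A $$ (r a, h a)) > 0"
    by (rule prod_pos) (simp add: h_def gA)
  ultimately have "(\<Prod>a\<in>{0..<m}. A $$ (r a, h a)) * minor_at m B h s > 0"
    using g by simp
  moreover have "h \<in> ?F"
    using g by (auto simp: h_def increasing_below_def)
  moreover have "finite ?F"
    by (rule finite_bounded_functions) auto
  moreover have rs: "r \<in> {..<m} \<rightarrow> {..<nr}" "s \<in> {..<m} \<rightarrow> {..<nc}"
    using r s by (auto simp: increasing_below_def)
  ultimately show ?thesis
    unfolding minor_mult[OF A(1) B rs]
    by (intro sum_pos2[where i = h] noncrossing_term_nonneg[OF A pos r]) auto
qed

section \<open>Powers of a product of two noncrossing matrices\<close>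

text \<open>Powers are defined by multiplication on the right, while the row expansion splits off
  the leftmost factor.\<close>

lemma pow_mat_Suc_left:
  fixes A :: "'a :: semiring_1 mat"
  assumes "A \<in> carrier_mat n n"
  shows "A ^\<^sub>m Suc k = A * A ^\<^sub>m k"
proof (induction k)
  case (Suc k)
  have "A ^\<^sub>m Suc (Suc k) = (A * A ^\<^sub>m k) * A"
    unfolding Suc.IH[symmetric] by (rule pow_mat.simps(2))
  also have "\<dots> = A * (A ^\<^sub>m k * A)"
    by (rule assoc_mult_mat[of _ n n _ n _ n]) (use assms in auto)
  finally show ?case by simp
qed (use assms in auto)

lemma det_pow_mat:
  fixes A :: "'a :: comm_ring_1 mat"
  assumes "A \<in> carrier_mat n n"
  shows "det (A ^\<^sub>m k) = det A ^ k"
  by (induction k) (use assms in \<open>auto simp: det_mult[of _ n] mult.commute\<close>)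

context
  fixes L U :: "real mat" and n :: nat
  assumes L: "L \<in> carrier_mat n n" "noncrossing_nonneg L"
    and U: "U \<in> carrier_mat n n" "noncrossing_nonneg U"
begin

lemma minor_noncrossing_mult2_nonneg:
  assumes B: "B \<in> carrier_mat n n"
    and pos: "\<And>f. increasing_below m n f \<Longrightarrow> minor_at m B f s \<ge> 0"
    and r: "increasing_below m n r" and s: "increasing_below m n s"
  shows "minor_at m (L * U * B) r s \<ge> 0"
proof -
  have "L * U * B = L * (U * B)"
    using L(1) U(1) B by (rule assoc_mult_mat)
  then show ?thesis
    using minor_noncrossing_mult_nonneg[OF L mult_carrier_mat[OF U(1) B]
        minor_noncrossing_mult_nonneg[OF U B pos _ s] r s] by simp
qed

lemma minor_power_nonneg:
  assumes "increasing_below m n r" "increasing_below m n s"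
  shows "minor_at m ((L * U) ^\<^sub>m k) r s \<ge> 0"
  using assms
proof (induction k arbitrary: r)
  case 0
  then show ?case using minor_one_nonneg L(1) by simp
next
  case (Suc k)
  show ?case
    unfolding pow_mat_Suc_left[OF mult_carrier_mat[OF L(1) U(1)]]
    by (rule minor_noncrossing_mult2_nonneg) (use Suc L(1) U(1) in auto)
qed

lemma totally_nonneg_mult: "totally_nonneg (L * U)"
  unfolding totally_nonneg_def
proof (intro allI impI)
  fix I J
  assume IJ: "I \<subseteq> {..<dim_row (L * U)} \<and> J \<subseteq> {..<dim_col (L * U)} \<and> card I = card J"
  then have "{i. i < n \<and> i \<in> I} = I" "{i. i < n \<and> i \<in> J} = J"
    using L(1) U(1) by auto
  then have "det (submatrix (L * U) I J) = minor_at (card I) (L * U) (pick I) (pick J)"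
    using IJ L(1) U(1) by (intro submatrix_minor) auto
  also have "\<dots> = minor_at (card I) ((L * U) ^\<^sub>m 1) (pick I) (pick J)"
    using L(1) U(1) by simp
  also have "\<dots> \<ge> 0"
    using IJ L(1) U(1) increasing_below_pick[of I n] increasing_below_pick[of J n]
    by (intro minor_power_nonneg) auto
  finally show "det (submatrix (L * U) I J) \<ge> 0" .
qed

context
  assumes L_pos: "\<And>i. i < n \<Longrightarrow> L $$ (i, i) > 0" "\<And>i. Suc i < n \<Longrightarrow> L $$ (Suc i, i) > 0"
    and U_pos: "\<And>i. i < n \<Longrightarrow> U $$ (i, i) > 0" "\<And>i. Suc i < n \<Longrightarrow> U $$ (i, Suc i) > 0"
begin

text \<open>
  One factor of the power moves every row index by one towards its target: the factor \<open>L\<close>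
  moves the indices that are too large, and \<open>U\<close> those that are too small.
\<close>

lemma minor_power_pos:
  assumes "increasing_below m n r" "increasing_below m n s"
    and "\<And>a. a < m \<Longrightarrow> r a \<le> s a + k \<and> s a \<le> r a + k"
  shows "minor_at m ((L * U) ^\<^sub>m k) r s > 0"
  using assms
proof (induction k arbitrary: r)
  case 0
  then have "r a = s a" if "a < m" for a
    using that by fastforce
  then show ?case
    using L(1) by (simp add: minor_one_diag[OF 0(2)])
next
  case (Suc k)
  let ?B = "(L * U) ^\<^sub>m k"
  have B: "?B \<in> carrier_mat n n" using L(1) U(1) by auto
  \<comment> \<open>\<open>g\<close> is the selection reached through \<open>L\<close>,
    \<open>h\<close> the one reached from it through \<open>U\<close>. Each index is moved by at
    most one of them, since lowering never passes below the target.\<close>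
  define g where "g a = (if r a > s a then r a - 1 else r a)" for a
  define h where "h a = (if g a < s a then g a + 1 else g a)" for a
  have rs: "r a < r b" "s a < s b" if "a < b" "b < m" for a b
    using Suc.prems(1,2) that by (auto simp: increasing_below_def strict_mono_on_def)
  have bnd: "r a < n" "s a < n" if "a < m" for a
    using Suc.prems(1,2) that by (auto simp: increasing_below_def)
  \<comment> \<open>The critical case lowers only \<open>r b\<close>: then
    \<open>r a \<le> s a < s b < r b\<close> leaves room for the step.\<close>
  have g_mono: "g a < g b" if "a < b" "b < m" for a b
    using rs[OF that] by (auto simp: g_def)
  have h_mono: "h a < h b" if "a < b" "b < m" for a b
    using rs[OF that] g_mono[OF that] by (auto simp: h_def)
  have g: "increasing_below m n g"
    using g_mono bnd by (auto simp: increasing_below_def strict_mono_on_def g_def less_imp_diff_less)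
  have h: "increasing_below m n h"
    unfolding increasing_below_def strict_mono_on_def
  proof (intro conjI Pi_I)
    fix a assume "a \<in> {..<m}"
    then show "h a \<in> {..<n}"
      using bnd[of a] by (auto simp: h_def g_def)
  qed (use h_mono in auto)
  have "minor_at m ?B h s > 0"
  proof (rule Suc.IH[OF h Suc.prems(2)])
    fix a assume "a < m"
    then show "h a \<le> s a + k \<and> s a \<le> h a + k"
      using Suc.prems(3)[of a] by (auto simp: h_def g_def)
  qed
  moreover have "U $$ (g a, h a) > 0" if "a < m" for a
    using that U_pos bnd[of a] by (auto simp: h_def g_def)
  ultimately have "minor_at m (U * ?B) g s > 0"
    using minor_noncrossing_mult_pos[OF U B minor_power_nonneg[OF _ Suc.prems(2)] g Suc.prems(2) h]
    by blast
  moreover have "L $$ (r a, g a) > 0" if "a < m" for a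
    using that L_pos(1)[of "r a"] L_pos(2)[of "r a - 1"] bnd[of a] by (auto simp: g_def)
  ultimately have "minor_at m (L * (U * ?B)) r s > 0"
    using minor_noncrossing_mult_pos[OF L mult_carrier_mat[OF U(1) B]
        minor_noncrossing_mult_nonneg[OF U B minor_power_nonneg[OF _ Suc.prems(2)] _ Suc.prems(2)]
        Suc.prems(1,2) g]
    by blast
  also have "L * (U * ?B) = (L * U) ^\<^sub>m Suc k"
    unfolding pow_mat_Suc_left[OF mult_carrier_mat[OF L(1) U(1)]]
    using L(1) U(1) B by (rule assoc_mult_mat[symmetric])
  finally show ?case .
qed

text \<open>Indices below \<open>n\<close> differ by less than \<open>n\<close>, so this many steps
  connect any two selections. \<open>Suc\<close> keeps the exponent positive even for
  \<open>n = 0\<close>.\<close>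

lemma totally_pos_power: "totally_pos ((L * U) ^\<^sub>m Suc n)"
  unfolding totally_pos_def
proof (intro allI impI)
  fix I J
  let ?P = "(L * U) ^\<^sub>m Suc n"
  assume IJ: "I \<subseteq> {..<dim_row ?P} \<and> J \<subseteq> {..<dim_col ?P} \<and> card I = card J"
  then have "{i. i < n \<and> i \<in> I} = I" "{i. i < n \<and> i \<in> J} = J"
    using L(1) U(1) by auto
  then have "det (submatrix ?P I J) = minor_at (card I) ?P (pick I) (pick J)"
    using IJ L(1) U(1) by (intro submatrix_minor) auto
  moreover have inc: "increasing_below (card I) n (pick I)" "increasing_below (card I) n (pick J)"
    using IJ L(1) U(1) increasing_below_pick[of I n] increasing_below_pick[of J n] by auto
  moreover have "minor_at (card I) ?P (pick I) (pick J) > 0"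
  proof (rule minor_power_pos[OF inc])
    fix a assume "a < card I"
    then have "pick I a < n" "pick J a < n"
      using inc by (auto simp: increasing_below_def)
    then show "pick I a \<le> pick J a + Suc n \<and> pick J a \<le> pick I a + Suc n"
      by simp
  qed
  ultimately show "det (submatrix ?P I J) > 0" by simp
qed

lemma oscillatory_mult: "oscillatory_mat (L * U)"
  unfolding oscillatory_mat_def
  using totally_nonneg_mult totally_pos_power L(1) U(1) by auto

end

end

section \<open>Determinants of oscillatory matrices\<close>

text \<open>The determinant is itself a minor, hence nonnegative; were it zero, so would be the
  determinant of every positive power.\<close>

lemma oscillatory_det_pos:
  assumes "oscillatory_mat A"
  shows "det A > 0"
proof -
  obtain k where k: "k > 0" "totally_pos (A ^\<^sub>m k)" and A: "square_mat A" "totally_nonneg A"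
    using assms by (auto simp: oscillatory_mat_def)
  define n where "n = dim_row A"
  have Ac: "A \<in> carrier_mat n n"
    using A by (auto simp: n_def)
  have full: "submatrix B {..<n} {..<n} = B" if "B \<in> carrier_mat n n" for B :: "real mat"
  proof -
    have "pick {..<n} i = i" if "i < n" for i
      using pick_card_in_set[of i "{..<n}"] that
      by (metis (no_types, lifting) Collect_cong card_Collect_less_nat lessThan_iff less_trans)
    then show ?thesis
      using that by (auto simp: submatrix_def intro!: eq_matI)
  qed
  have "det A \<ge> 0"
    using A(2) full[OF Ac] Ac unfolding totally_nonneg_def by (metis carrier_matD order_refl)
  moreover have "A ^\<^sub>m k \<in> carrier_mat n n"
    using Ac by auto
  then have "det (A ^\<^sub>m k) > 0"
    using k(2) full[of "A ^\<^sub>m k"] unfolding totally_pos_def by (metis carrier_matD order_refl)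
  then have "det A \<noteq> 0"
    using k(1) by (auto simp: det_pow_mat[OF Ac] zero_power)
  ultimately show ?thesis by simp
qed

section \<open>Truncations, and oscillation from a positive factorization\<close>

lemma leading_submat_carrier [simp]: "leading_submat A n \<in> carrier_mat n n"
  by (simp add: leading_submat_def)

text \<open>Row \<open>i\<close> of a lower triangular \<open>A\<close> reaches only the rows of
  \<open>B\<close> up to \<open>i\<close>, so truncation loses no term of the sum.\<close>

lemma leading_submat_mult:
  assumes "\<And>i k. i < k \<Longrightarrow> A i k = 0"
  shows "leading_submat (smat_mult A B) n = leading_submat A n * leading_submat B n"
proof (rule eq_matI)
  fix i j assume "i < dim_row (leading_submat A n * leading_submat B n)"
    "j < dim_col (leading_submat A n * leading_submat B n)"
  then have ij: "i < n" "j < n" by (auto simp: leading_submat_def)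
  have "smat_mult A B i j = (\<Sum>k\<le>i. A i k * B k j)"
    by (rule smat_mult_lower_triangular) (rule assms)
  also have "\<dots> = (\<Sum>k = 0..<n. A i k * B k j)"
    using ij assms by (intro sum.mono_neutral_left) auto
  finally show "leading_submat (smat_mult A B) n $$ (i, j) =
      (leading_submat A n * leading_submat B n) $$ (i, j)"
    using ij by (auto simp: leading_submat_def scalar_prod_def)
qed (auto simp: leading_submat_def)

lemma leading_submat_pbf:
  "leading_submat (smat_mult (pbf_L \<beta>) (pbf_U \<beta>)) n =
    leading_submat (pbf_L \<beta>) n * leading_submat (pbf_U \<beta>) n"
  by (rule leading_submat_mult) (simp add: pbf_L_def)

lemma admits_PBF_imp_oscillatory:
  assumes "admits_PBF J"
  shows "oscillatory_smat J"
  unfolding oscillatory_smat_def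
proof (intro allI impI)
  fix n :: nat
  obtain \<beta> where pos: "\<And>n. n \<ge> 1 \<Longrightarrow> \<beta> n > 0" and J: "J = smat_mult (pbf_L \<beta>) (pbf_U \<beta>)"
    using assms by (auto simp: admits_PBF_def)
  have "noncrossing_nonneg (leading_submat (pbf_L \<beta>) n)"
    using pos by (auto simp: noncrossing_nonneg_def leading_submat_def pbf_L_def less_imp_le
        split: if_splits)
  moreover have "noncrossing_nonneg (leading_submat (pbf_U \<beta>) n)"
    using pos by (auto simp: noncrossing_nonneg_def leading_submat_def pbf_U_def less_imp_le
        split: if_splits)
  ultimately show "oscillatory_mat (leading_submat J n)"
    unfolding J leading_submat_pbf
    by (intro oscillatory_mult[of _ n])
      (use pos in \<open>auto simp: leading_submat_def pbf_L_def pbf_U_def\<close>)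
qed

text \<open>No sign of \<open>\<beta>\<close> is assumed, so this applies to the elimination
  coefficients before they are known to be positive.\<close>

lemma det_leading_pbf:
  "det (leading_submat (smat_mult (pbf_L \<beta>) (pbf_U \<beta>)) n) = (\<Prod>i<n. \<beta> (2 * i + 1))"
proof -
  let ?L = "leading_submat (pbf_L \<beta>) n" and ?U = "leading_submat (pbf_U \<beta>) n"
  have "det ?L = prod_list (diag_mat ?L)"
    by (rule det_lower_triangular[of n]) (auto simp: leading_submat_def pbf_L_def)
  also have "diag_mat ?L = map (\<lambda>i. 1) [0..<n]"
    by (auto simp: diag_mat_def leading_submat_def pbf_L_def)
  also have "prod_list \<dots> = 1"
    by (induction n) auto
  finally have detL: "det ?L = 1" .
  have "det ?U = prod_list (diag_mat ?U)"
    by (rule det_upper_triangular[of _ n])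
      (auto simp: leading_submat_def pbf_U_def upper_triangular_def)
  also have "diag_mat ?U = map (\<lambda>i. \<beta> (2 * i + 1)) [0..<n]"
    by (auto simp: diag_mat_def leading_submat_def pbf_U_def)
  also have "prod_list \<dots> = (\<Prod>i<n. \<beta> (2 * i + 1))"
    by (simp add: prod.distinct_set_conv_list[symmetric] lessThan_atLeast0)
  finally show ?thesis
    unfolding leading_submat_pbf by (simp add: detL det_mult[of _ n])
qed

section \<open>Pivots, and a positive factorization from oscillation\<close>

text \<open>
  A vanishing pivot makes the later ones meaningless, as \<open>x / 0 = 0\<close>.
\<close>

primrec pivot :: "smat \<Rightarrow> nat \<Rightarrow> real" where
  "pivot J 0 = J 0 0"
| "pivot J (Suc i) = J (Suc i) (Suc i) - J (Suc i) i / pivot J i"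

text \<open>Odd positions carry the pivots, the diagonal of \<open>U\<close>; even positions carry
  the elimination multipliers, the subdiagonal of \<open>L\<close>. The value at 0 never enters the
  factors.\<close>

definition pbf_coeff :: "smat \<Rightarrow> nat \<Rightarrow> real" where
  "pbf_coeff J n =
    (let i = (n - 1) div 2 in if odd n then pivot J i else J (Suc i) i / pivot J i)"

lemma pbf_coeff_simps [simp]:
  "pbf_coeff J (Suc 0) = J 0 0"
  "pbf_coeff J (Suc (2 * i)) = pivot J i"
  "pbf_coeff J (Suc (Suc (Suc (2 * i)))) = pivot J (Suc i)"
  "pbf_coeff J (Suc (Suc (2 * i))) = J (Suc i) i / pivot J i"
  by (simp_all add: pbf_coeff_def)

text \<open>Row \<open>i\<close> divides only by the pivot before it, so \<open>pivot J i\<close>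
  itself may vanish. This makes the lemma usable while positivity of the pivots is still being
  proved.\<close>

lemma pbf_coeff_product:
  assumes J: "jacobi_matrix J" and nz: "\<And>k. k < i \<Longrightarrow> pivot J k \<noteq> 0"
  shows "smat_mult (pbf_L (pbf_coeff J)) (pbf_U (pbf_coeff J)) i j = J i j"
proof -
  let ?L = "pbf_L (pbf_coeff J)" and ?U = "pbf_U (pbf_coeff J)"
  have sup: "J i (Suc i) = 1" and zero: "j > i + 1 \<or> i > j + 1 \<Longrightarrow> J i j = 0" for i j
    using J by (auto simp: jacobi_matrix_def)
  have eq: "smat_mult ?L ?U i j = (\<Sum>k\<le>i. ?L i k * ?U k j)"
    by (rule smat_mult_lower_triangular) (simp add: pbf_L_def)
  show ?thesis
  proof (cases i)
    case 0
    then show ?thesis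
      using eq sup[of 0] zero[of 0 j] by (auto simp: pbf_L_def pbf_U_def)
  next
    case (Suc p)
    have "(\<Sum>k\<le>i. ?L i k * ?U k j) = (\<Sum>k\<in>{p, Suc p}. ?L i k * ?U k j)"
      by (rule sum.mono_neutral_right) (auto simp: Suc pbf_L_def)
    also have "\<dots> = J (Suc p) p / pivot J p * ?U p j + ?U (Suc p) j"
      by (simp add: Suc pbf_L_def)
    also have "\<dots> = J i j"
    proof -
      consider "j = p" | "j = Suc p" | "j = Suc (Suc p)" | "j < p" | "j > Suc (Suc p)"
        by linarith
      \<comment> \<open>For \<open>j = p\<close> the pivot cancels, for \<open>j = Suc p\<close> the
        recursion of \<open>pivot\<close> applies, and for \<open>j = Suc (Suc p)\<close> only the
        superdiagonal one remains.\<close>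
      then show ?thesis
        using nz[of p] sup[of i] zero[of j i] by cases (auto simp: Suc pbf_U_def zero sup)
    qed
    finally show ?thesis using eq by simp
  qed
qed

text \<open>Once the earlier pivots are positive, the factorization holds through row
  \<open>i\<close>. The leading minor of order \<open>Suc i\<close> is then the product of the
  pivots up to \<open>i\<close>; it is positive, and so is the product of the earlier ones.\<close>

lemma oscillatory_pivot_pos:
  assumes J: "jacobi_matrix J" and osc: "oscillatory_smat J"
  shows "pivot J i > 0"
proof (induction i rule: less_induct)
  case (less i)
  let ?P = "smat_mult (pbf_L (pbf_coeff J)) (pbf_U (pbf_coeff J))"
  have "?P a b = J a b" if "a < Suc i" for a b
    using less that by (intro pbf_coeff_product[OF J]) (metis less_trans_Suc less_irrefl not_less_eq)
  then have "leading_submat J (Suc i) = leading_submat ?P (Suc i)"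
    by (auto simp: leading_submat_def intro!: eq_matI)
  moreover have "det (leading_submat J (Suc i)) > 0"
    using osc by (intro oscillatory_det_pos) (simp add: oscillatory_smat_def)
  ultimately have "(\<Prod>k<i. pivot J k) * pivot J i > 0"
    by (simp add: det_leading_pbf)
  moreover have "(\<Prod>k<i. pivot J k) > 0"
    using less by (intro prod_pos) auto
  ultimately show ?case
    by (simp add: zero_less_mult_iff)
qed

lemma oscillatory_imp_admits_PBF:
  assumes J: "jacobi_matrix J" and osc: "oscillatory_smat J"
  shows "admits_PBF J"
proof -
  note pos = oscillatory_pivot_pos[OF assms]
  \<comment> \<open>Even coefficients are positive subdiagonal entries divided by positive
    pivots.\<close>
  have "pbf_coeff J n > 0" if "n \<ge> 1" for n
    using that pos J by (simp add: pbf_coeff_def Let_def jacobi_matrix_def)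
  moreover have "J = smat_mult (pbf_L (pbf_coeff J)) (pbf_U (pbf_coeff J))"
    using pos by (intro ext pbf_coeff_product[OF J, symmetric]) (metis less_irrefl)
  ultimately show ?thesis
    unfolding admits_PBF_def by blast
qed

theorem proposition1:
  fixes J :: smat
  assumes "jacobi_matrix J"
  shows "oscillatory_smat J \<longleftrightarrow> admits_PBF J"
  using admits_PBF_imp_oscillatory oscillatory_imp_admits_PBF[OF assms] by blast

end
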